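(* There exists an absolute constant $C>0$ such that for every integer $n\ge 5$ and every simple graph $G$ of order $n$ (not necessarily connected) with exactly $d\ge 2$ distinct eigenvalues, there exists a switching $s\in\{\pm1\}^n$ such that $$M_*(s)\ \ge\ d - C\,\frac{d}{(\log d)^{1/4}}.$$
   Context: Let $G$ be a finite simple undirected graph on vertex set $\{1,\dots,n\}$ with (0/1) adjacency matrix $A(G)$; the eigenvalues of $G$ are those of $A(G)$. A switching is a vector $s=(s_1,\dots,s_n)\in\{\pm1\}^n$. The signed graph $G^{s}$ has underlying graph $G$ and sign $s_is_j$ on each edge $ij$; its adjacency matrix is $A(G^{s})=D_sA(G)D_s$, where $D_s$ is the diagonal matrix with diagonal $s$. An eigenvalue $\lambda$ of $A(G^s)$ is called main if it has an eigenvector not orthogonal to the all-ones vector. Let $\operatorname{spec}(G)$ be the set of distinct eigenvalues of $A(G)$, so $d=|\operatorname{spec}(G)|$; for $\lambda\in\operatorname{spec}(G)$ let $E_\lambda\subseteq\mathbb{R}^n$ be the $\lambda$-eigenspace of $A(G)$. Let $s^\perp=\{x\in\mathbb{R}^n: s^\top x=0\}$. Define $$M_*(s):=\bigl|\{\lambda\in\operatorname{spec}(G): E_\lambda\not\subseteq s^\perp\}\bigr| .$$ Thus $M_*(s)$ is the number of distinct main eigenvalues of $G^{s}$. *)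

theory Defs
  imports
    "Graph_Theory.Pair_Digraph"
    "Jordan_Normal_Form.Spectral_Radius"
begin

text \<open>
  A finite simple undirected graph is a \<open>pair_graph\<close>: finitely many vertices, a symmetric
  irreflexive set of ordered pairs as arcs, each edge being represented by its two orientations.
  Vertices are numbered from 0 to \<open>n - 1\<close>, to agree with the indices of vectors and matrices.
\<close>

definition simple_graph_on :: "nat \<Rightarrow> nat pair_pre_digraph \<Rightarrow> bool" where
  "simple_graph_on n G \<longleftrightarrow> pair_graph G \<and> pverts G = {..<n}"

definition adjacency_matrix :: "nat \<Rightarrow> nat pair_pre_digraph \<Rightarrow> real mat" where
  "adjacency_matrix n G = mat n n (\<lambda>(i, j). if (i, j) \<in> parcs G then 1 else 0)"

definition eigenspace :: "real mat \<Rightarrow> real \<Rightarrow> real vec set" where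
  "eigenspace A \<mu> = {x \<in> carrier_vec (dim_row A). A *\<^sub>v x = \<mu> \<cdot>\<^sub>v x}"

definition switchings :: "nat \<Rightarrow> real vec set" where
  "switchings n = {s \<in> carrier_vec n. \<forall>i<n. s $ i \<in> {1, -1}}"

definition perp :: "real vec \<Rightarrow> real vec set" where
  "perp s = {x \<in> carrier_vec (dim_vec s). s \<bullet> x = 0}"

definition M_star :: "nat \<Rightarrow> nat pair_pre_digraph \<Rightarrow> real vec \<Rightarrow> nat" where
  "M_star n G s =
     card {\<mu> \<in> spectrum (adjacency_matrix n G). \<not> eigenspace (adjacency_matrix n G) \<mu> \<subseteq> perp s}"

text \<open>
  \<open>M_star n G s\<close> counts the distinct main eigenvalues of the signed graph obtained by switching.
\<close>

definition signed_adjacency_matrix :: "nat \<Rightarrow> nat pair_pre_digraph \<Rightarrow> real vec \<Rightarrow> real mat" where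
  "signed_adjacency_matrix n G s =
     mat_diag n (($) s) * adjacency_matrix n G * mat_diag n (($) s)"

definition main_eigenvalue :: "real mat \<Rightarrow> real \<Rightarrow> bool" where
  "main_eigenvalue A \<mu> \<longleftrightarrow> (\<exists>v. eigenvector A v \<mu> \<and> vec (dim_row A) (\<lambda>_. 1) \<bullet> v \<noteq> 0)"

lemma adjacency_matrix_carrier: "adjacency_matrix n G \<in> carrier_mat n n"
  by (simp add: adjacency_matrix_def)

lemma mat_diag_mult_vec_entrywise:
  assumes "s \<in> carrier_vec n" "x \<in> carrier_vec n"
  shows "mat_diag n (($) s) *\<^sub>v x = vec n (\<lambda>i. s $ i * x $ i)"
proof (rule eq_vecI)
  fix i assume "i < dim_vec (vec n (\<lambda>i. s $ i * x $ i))"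
  then have i: "i < n" by simp
  have "(mat_diag n (($) s) *\<^sub>v x) $ i = (\<Sum>j\<in>{0..<n}. (if i = j then s $ j else 0) * x $ j)"
    using assms i by (auto simp: mat_diag_def scalar_prod_def)
  also have "\<dots> = (\<Sum>j\<in>{0..<n}. if j = i then s $ i * x $ i else 0)"
    by (rule sum.cong) auto
  also have "\<dots> = s $ i * x $ i" using i by simp
  finally show "(mat_diag n (($) s) *\<^sub>v x) $ i = vec n (\<lambda>i. s $ i * x $ i) $ i" using i by simp
qed (use assms in \<open>auto simp: mat_diag_def\<close>)

lemma switching_sq: "s \<in> switchings n \<Longrightarrow> i < n \<Longrightarrow> s $ i * s $ i = 1"
  by (auto simp: switchings_def)

lemma mat_diag_involution:
  assumes "s \<in> switchings n" "x \<in> carrier_vec n"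
  shows "mat_diag n (($) s) *\<^sub>v (mat_diag n (($) s) *\<^sub>v x) = x"
proof -
  have s: "s \<in> carrier_vec n" using assms by (simp add: switchings_def)
  show ?thesis
    using assms switching_sq[OF assms(1)]
    by (auto simp: mat_diag_mult_vec_entrywise[OF s] mult.assoc[symmetric])
qed

lemma main_eigenvalue_iff:
  assumes s: "s \<in> switchings n"
  shows "main_eigenvalue (signed_adjacency_matrix n G s) \<mu> \<longleftrightarrow>
         \<mu> \<in> spectrum (adjacency_matrix n G) \<and> \<not> eigenspace (adjacency_matrix n G) \<mu> \<subseteq> perp s"
    (is "?L \<longleftrightarrow> ?R")
proof -
  let ?A = "adjacency_matrix n G" and ?D = "mat_diag n (($) s)"
  let ?B = "signed_adjacency_matrix n G s" and ?j = "vec n (\<lambda>_. 1) :: real vec"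
  have sc: "s \<in> carrier_vec n" using s by (simp add: switchings_def)
  have D: "?D \<in> carrier_mat n n" and A: "?A \<in> carrier_mat n n"
    using adjacency_matrix_carrier by auto
  have B: "?B \<in> carrier_mat n n"
    unfolding signed_adjacency_matrix_def using mult_carrier_mat[OF mult_carrier_mat[OF D A] D] .
  have dims: "dim_row ?A = n" "dim_row ?B = n" "dim_vec s = n" using A B sc by auto
  have Bv: "?B *\<^sub>v v = ?D *\<^sub>v (?A *\<^sub>v (?D *\<^sub>v v))" if "v \<in> carrier_vec n" for v
    unfolding signed_adjacency_matrix_def
    by (metis A D assoc_mult_mat_vec mult_carrier_mat mult_mat_vec_carrier that)
  have ip: "?j \<bullet> v = s \<bullet> (?D *\<^sub>v v)" if "v \<in> carrier_vec n" for v
    using that sc switching_sq[OF s]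
    by (auto simp: mat_diag_mult_vec_entrywise[OF sc] scalar_prod_def mult.assoc[symmetric] intro!: sum.cong)
  note Dc = mult_mat_vec_carrier[OF D] and Ac = mult_mat_vec_carrier[OF A]
  show ?thesis
  proof
    assume ?L
    then obtain v where v: "v \<in> carrier_vec n" "v \<noteq> 0\<^sub>v n" "?B *\<^sub>v v = \<mu> \<cdot>\<^sub>v v" "?j \<bullet> v \<noteq> 0"
      by (auto simp: main_eigenvalue_def eigenvector_def dims)
    let ?w = "?D *\<^sub>v v"
    have w: "?w \<in> carrier_vec n" using Dc v by simp
    have "?A *\<^sub>v ?w = ?D *\<^sub>v (?B *\<^sub>v v)"
      unfolding Bv[OF v(1)] mat_diag_involution[OF s Ac[OF w]] ..
    also have "\<dots> = \<mu> \<cdot>\<^sub>v ?w" using v mult_mat_vec[OF D v(1)] by simp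
    finally have e: "?A *\<^sub>v ?w = \<mu> \<cdot>\<^sub>v ?w" .
    have sw: "s \<bullet> ?w \<noteq> 0" using ip v by simp
    then have "?w \<noteq> 0\<^sub>v n" using sc by auto
    then have "\<mu> \<in> spectrum ?A"
      using e w by (auto simp: spectrum_def eigenvalue_def eigenvector_def dims)
    moreover have "?w \<in> eigenspace ?A \<mu> - perp s"
      using e w sw by (simp add: eigenspace_def perp_def dims)
    ultimately show ?R by blast
  next
    assume ?R
    then obtain w where w: "w \<in> carrier_vec n" "?A *\<^sub>v w = \<mu> \<cdot>\<^sub>v w" "s \<bullet> w \<noteq> 0"
      by (auto simp: eigenspace_def perp_def dims)
    let ?v = "?D *\<^sub>v w"
    have v: "?v \<in> carrier_vec n" using Dc w by simp
    have "?B *\<^sub>v ?v = \<mu> \<cdot>\<^sub>v ?v"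
      using Bv[OF v] mat_diag_involution[OF s w(1)] w mult_mat_vec[OF D w(1)] by simp
    moreover have "?j \<bullet> ?v \<noteq> 0" using ip[OF v] mat_diag_involution[OF s w(1)] w by simp
    moreover from this have "?v \<noteq> 0\<^sub>v n" by auto
    ultimately show ?L using v
      by (auto simp: main_eigenvalue_def eigenvector_def dims)
  qed
qed

lemma M_star_eq_card_main_eigenvalues:
  assumes "s \<in> switchings n"
  shows "M_star n G s = card {\<mu>. main_eigenvalue (signed_adjacency_matrix n G s) \<mu>}"
  using main_eigenvalue_iff[OF assms] by (simp add: M_star_def)

end

theory Submission
  imports Defs
begin

text \<open>
  Choose the switching uniformly at random. If an eigenspace contains a vector with more than
  \<open>k\<close> nonzero entries, then by the Littlewood--Offord inequality it lies in the random hyperplane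
  with probability at most \<open>1 / sqrt (k + 2)\<close>. An eigenvector with at most \<open>k\<close> nonzero entries
  restricts to an eigenvector of the subgraph induced on its support, and the graphs on at most
  \<open>k\<close> vertices have at most \<open>4 ^ k\<^sup>2\<close> eigenvalues altogether. Both error terms are
  of order at most \<open>d / (ln d) powr (1/4)\<close> when \<open>k\<close> is about \<open>sqrt (ln d) / 2\<close>.
\<close>

section \<open>The Littlewood--Offord inequality\<close>

text \<open>
  The induction averages, over \<open>x \<in> X\<close>, the inequality for the members of \<open>F\<close> that avoid \<open>x\<close>.
\<close>

lemma lym_inequality:
  assumes "finite X" "F \<subseteq> Pow X" "\<And>A B. A \<in> F \<Longrightarrow> B \<in> F \<Longrightarrow> \<not> A \<subset> B"
  shows "(\<Sum>A\<in>F. 1 / real (card X choose card A)) \<le> 1"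
  using assms
proof (induction "card X" arbitrary: X F)
  case 0
  then have "X = {}" by simp
  then have "F = {} \<or> F = {{}}" using 0 by (auto simp: subset_singleton_iff)
  then show ?case using \<open>X = {}\<close> by auto
next
  case (Suc n)
  note X = \<open>finite X\<close> and F = \<open>F \<subseteq> Pow X\<close>
  have finF: "finite F" using X F by (meson finite_Pow_iff finite_subset)
  show ?case
  proof (cases "X \<in> F")
    case True
    then have "F = {X}" using F Suc.prems(3) by blast
    then show ?thesis by simp
  next
    case False
    \<comment> \<open>\<open>w\<close> is the weight of \<open>A\<close> in a ground set with one
      point fewer. \<open>A\<close> avoids \<open>Suc n - card A\<close> points of \<open>X\<close>,
      and by the absorption identity the total over them is \<open>Suc n\<close> times the weight of
      \<open>A\<close> in \<open>X\<close>.\<close>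
    define w where "w A = 1 / real (n choose card A)" for A :: "'a set"
    have w: "(\<Sum>x\<in>X - A. w A) = real (Suc n) / real (card X choose card A)" if A: "A \<in> F" for A
    proof -
      have sub: "A \<subset> X" using F A False by blast
      then have less: "card A < Suc n" using X Suc.hyps(2) by (simp add: psubset_card_mono)
      have "(Suc n - card A) * (Suc n choose card A) = Suc n * (n choose card A)"
        using binomial_absorb_comp[of "Suc n" "card A"] by simp
      then have "real (Suc n - card A) * real (Suc n choose card A)
          = real (Suc n) * real (n choose card A)"
        by (metis of_nat_mult)
      moreover have "card (X - A) = Suc n - card A"
        using sub X Suc.hyps(2) by (metis card_Diff_subset finite_subset psubset_imp_subset)
      ultimately show ?thesis
        using less Suc.hyps(2)[symmetric] by (simp add: w_def field_simps del: binomial_Suc_Suc)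
    qed
    have "real (Suc n) * (\<Sum>A\<in>F. 1 / real (card X choose card A)) = (\<Sum>A\<in>F. \<Sum>x\<in>X - A. w A)"
      unfolding sum_distrib_left by (rule sum.cong[OF refl]) (simp only: w times_divide_eq_right mult_1_right)
    also have "\<dots> = (\<Sum>A\<in>F. \<Sum>x | x \<in> X \<and> x \<notin> A. w A)"
      by (simp add: set_diff_eq)
    also have "\<dots> = (\<Sum>x\<in>X. \<Sum>A | A \<in> F \<and> x \<notin> A. w A)"
      by (rule sum.swap_restrict[OF finF X])
    also have "\<dots> \<le> (\<Sum>x\<in>X. 1)"
    proof (rule sum_mono)
      fix x assume x: "x \<in> X"
      \<comment> \<open>The members avoiding \<open>x\<close> form an antichain in
        \<open>X - {x}\<close>, so the induction hypothesis bounds their total weight.\<close>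
      have "n = card (X - {x})" using x X Suc.hyps(2) by simp
      then show "(\<Sum>A | A \<in> F \<and> x \<notin> A. w A) \<le> 1"
        using Suc.hyps(1)[of "X - {x}" "{A. A \<in> F \<and> x \<notin> A}"] X F Suc.prems(3)
        by (auto simp: w_def)
    qed
    also have "\<dots> = real (Suc n)" using Suc.hyps(2) by simp
    finally show ?thesis by simp
  qed
qed

text \<open>The middle binomial coefficient is the largest, so each summand in the LYM inequality is
  at least its reciprocal.\<close>

lemma sperner:
  assumes "finite X" "F \<subseteq> Pow X" "\<And>A B. A \<in> F \<Longrightarrow> B \<in> F \<Longrightarrow> \<not> A \<subset> B"
  shows "card F \<le> card X choose (card X div 2)"
proof -
  let ?c = "real (card X choose (card X div 2))"
  have c: "?c > 0" by simp
  have "real (card F) / ?c = (\<Sum>A\<in>F. 1 / ?c)" by simp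
  also have "\<dots> \<le> (\<Sum>A\<in>F. 1 / real (card X choose card A))"
  proof (rule sum_mono)
    fix A assume "A \<in> F"
    then have "card A \<le> card X" using assms by (auto intro: card_mono)
    then show "1 / ?c \<le> 1 / real (card X choose card A)"
      by (intro divide_left_mono) (auto simp: binomial_maximum)
  qed
  also have "\<dots> \<le> 1" using lym_inequality[OF assms] .
  finally show ?thesis using c by (simp add: field_simps)
qed

section \<open>Upper bounds for the central binomial coefficient\<close>

text \<open>The left side grows by the factor
  \<open>4 * (2 * j + 1) * (2 * j + 3) / (j + 1)^2\<close> at each step. This is at most 16, because
  \<open>(2 * j + 1) * (2 * j + 3)\<close> is just below \<open>(2 * j + 2)^2\<close>.\<close>

lemma central_binomial_even_le: "((2 * j) choose j)\<^sup>2 * (2 * j + 1) \<le> (16::nat) ^ j"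
proof (induction j)
  case (Suc j)
  let ?c = "(2 * j) choose j" and ?d = "(2 * Suc j) choose Suc j"
  have d: "Suc j * ?d = 2 * (2 * j + 1) * ?c"
  proof -
    have "Suc j * ?d = 2 * (Suc j * ((2 * j + 1) choose j))"
      using Suc_times_binomial_eq[of "2 * j + 1" j] by (simp add: algebra_simps del: binomial_Suc_Suc)
    moreover have "(2 * j + 1) choose j = (2 * j + 1) choose Suc j"
      using binomial_symmetric[of j "2 * j + 1"] by simp
    moreover have "Suc j * ((2 * j + 1) choose Suc j) = (2 * j + 1) * ?c"
      using Suc_times_binomial_eq[of "2 * j" j] by (simp add: algebra_simps del: binomial_Suc_Suc)
    ultimately show ?thesis by (simp only: mult.assoc)
  qed
  have "(Suc j)\<^sup>2 * (?d\<^sup>2 * (2 * Suc j + 1)) = (Suc j * ?d)\<^sup>2 * (2 * j + 3)"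
    by (simp only: power_mult_distrib mult.assoc) (simp del: binomial_Suc_Suc add: distrib_left)
  also have "\<dots> = 4 * (2 * j + 1) * (2 * j + 3) * (?c\<^sup>2 * (2 * j + 1))"
    unfolding d by (simp add: power2_eq_square algebra_simps)
  also have "\<dots> \<le> 16 * (Suc j)\<^sup>2 * 16 ^ j"
    by (rule mult_mono[OF _ Suc]) (auto simp: power2_eq_square algebra_simps)
  also have "\<dots> = (Suc j)\<^sup>2 * 16 ^ Suc j" by simp
  finally show ?case by (simp del: binomial_Suc_Suc)
qed simp

lemma central_binomial_le: "(m choose (m div 2))\<^sup>2 * (m + 1) \<le> (4::nat) ^ m"
proof (cases "even m")
  case True
  then obtain j where "m = 2 * j" by blast
  then show ?thesis using central_binomial_even_le[of j] by (simp add: power_mult)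
next
  case False
  then obtain j where m: "m = 2 * j + 1" by (metis oddE)
  let ?c = "m choose j"
  \<comment> \<open>By Pascal's rule the next even central coefficient is the sum of the two equal
    middle coefficients of the odd row, which reduces the odd case to the even one.\<close>
  have "(2 * Suc j) choose Suc j = 2 * ?c"
    using binomial_symmetric[of j "2 * j + 1"] m by simp
  then have "(2 * ?c)\<^sup>2 * (2 * Suc j + 1) \<le> 16 ^ Suc j"
    using central_binomial_even_le[of "Suc j"] by (simp only:)
  then have "4 * (?c\<^sup>2 * (2 * j + 3)) \<le> 4 * (4 * 16 ^ j)"
    by (simp add: power_mult_distrib algebra_simps)
  then have "?c\<^sup>2 * (2 * j + 3) \<le> 4 * 16 ^ j"
    by (rule mult_left_le_imp_le) simp
  then have "?c\<^sup>2 * (2 * j + 2) \<le> 4 * 16 ^ j"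
    by (rule order_trans[rotated]) (rule mult_left_mono, auto)
  then show ?thesis using m by (simp add: power_mult)
qed

lemma central_binomial_le_real:
  "real (m choose (m div 2)) \<le> 2 ^ m / sqrt (real (m + 1))"
proof -
  let ?c = "real (m choose (m div 2))"
  have "?c\<^sup>2 * real (m + 1) = real ((m choose (m div 2))\<^sup>2 * (m + 1))"
    by (simp only: of_nat_mult of_nat_power)
  also have "\<dots> \<le> real (4 ^ m)"
    using central_binomial_le by (simp only: of_nat_le_iff)
  also have "\<dots> = (2 ^ m)\<^sup>2"
    by (simp add: power2_eq_square flip: power_mult_distrib)
  finally have "?c\<^sup>2 * real (m + 1) \<le> (2 ^ m)\<^sup>2" .
  then have "sqrt (?c\<^sup>2 * real (m + 1)) \<le> 2 ^ m"
    by (rule real_le_lsqrt[rotated]) auto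
  then have "?c * sqrt (real (m + 1)) \<le> 2 ^ m"
    by (simp add: real_sqrt_mult)
  then show ?thesis by (simp add: field_simps)
qed

section \<open>Concentration of signed sums\<close>

text \<open>A choice of signs is encoded by the set \<open>T\<close> of indices with sign +1, so
  that families of sign choices become set families to which Sperner's theorem applies.\<close>

definition sign_sum :: "'a set \<Rightarrow> ('a \<Rightarrow> real) \<Rightarrow> 'a set \<Rightarrow> real" where
  "sign_sum X a T = (\<Sum>i\<in>X. (if i \<in> T then 1 else -1) * a i)"

text \<open>
  Exchanging membership at the indices where \<open>a\<close> is negative makes \<open>sign_sum X a\<close> strictly
  monotone, so its level sets become antichains.
\<close>

lemma littlewood_offord:
  assumes X: "finite X" and a: "\<And>i. i \<in> X \<Longrightarrow> a i \<noteq> 0"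
  shows "card {T \<in> Pow X. sign_sum X a T = c} \<le> card X choose (card X div 2)"
proof -
  define N where "N = {i \<in> X. a i < 0}"
  let ?F = "{T \<in> Pow X. sign_sum X a T = c}" and ?flip = "\<lambda>T. sym_diff T N"
  have flip: "sign_sum X a T = sign_sum X (\<lambda>i. \<bar>a i\<bar>) (?flip T)" for T
    unfolding sign_sum_def by (rule sum.cong) (auto simp: N_def)
  have strict: "sign_sum X (\<lambda>i. \<bar>a i\<bar>) A < sign_sum X (\<lambda>i. \<bar>a i\<bar>) B"
    if AB: "A \<subset> B" "B \<subseteq> X" for A B
  proof -
    obtain x where "x \<in> B" "x \<notin> A" using AB by blast
    then show ?thesis
      unfolding sign_sum_def using X AB a
      by (intro sum_strict_mono_ex1) (auto intro!: bexI[of _ x])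
  qed
  have "inj_on ?flip ?F" by (rule inj_onI) blast
  then have "card ?F = card (?flip ` ?F)" by (simp add: card_image)
  also have "\<dots> \<le> card X choose (card X div 2)"
  proof (rule sperner[OF X])
    show "?flip ` ?F \<subseteq> Pow X" by (auto simp: N_def)
    fix A B assume "A \<in> ?flip ` ?F" "B \<in> ?flip ` ?F"
    then have "sign_sum X (\<lambda>i. \<bar>a i\<bar>) A = c" "sign_sum X (\<lambda>i. \<bar>a i\<bar>) B = c" "B \<subseteq> X"
      using flip by (auto simp: N_def)
    then show "\<not> A \<subset> B" using strict[of A B] by auto
  qed
  finally show ?thesis .
qed

text \<open>The signs outside the support do not affect the sum. They contribute a free factor
  \<open>2 ^ (card X - card S)\<close>, and the inequality for nonzero coefficients applies on
  \<open>S\<close>.\<close>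

lemma littlewood_offord_support:
  assumes X: "finite X" and S: "S = {i \<in> X. a i \<noteq> 0}"
  shows "real (card {T \<in> Pow X. sign_sum X a T = c}) \<le> 2 ^ card X / sqrt (real (card S + 1))"
proof -
  let ?F = "{T \<in> Pow X. sign_sum X a T = c}" and ?FS = "{T \<in> Pow S. sign_sum S a T = c}"
  have SX: "S \<subseteq> X" "finite S" using X S by auto
  have restrict: "sign_sum X a T = sign_sum S a (T \<inter> S)" for T
    unfolding sign_sum_def by (rule sum.mono_neutral_cong_right) (use X S in auto)
  have "inj_on (\<lambda>T. (T \<inter> S, T - S)) ?F" by (rule inj_onI) blast
  moreover have "(\<lambda>T. (T \<inter> S, T - S)) ` ?F \<subseteq> ?FS \<times> Pow (X - S)"
    using restrict by auto
  ultimately have "card ?F \<le> card (?FS \<times> Pow (X - S))"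
    using X SX by (intro card_inj_on_le) auto
  also have "\<dots> = card ?FS * 2 ^ (card X - card S)"
    using X SX by (simp add: card_cartesian_product card_Pow card_Diff_subset)
  finally have "real (card ?F) \<le> real (card ?FS * 2 ^ (card X - card S))"
    by (simp only: of_nat_le_iff)
  also have "\<dots> = real (card ?FS) * 2 ^ (card X - card S)" by simp
  also have "\<dots> \<le> (2 ^ card S / sqrt (real (card S + 1))) * 2 ^ (card X - card S)"
  proof (rule mult_right_mono)
    have "card ?FS \<le> card S choose (card S div 2)"
      using SX S by (intro littlewood_offord) auto
    then show "real (card ?FS) \<le> 2 ^ card S / sqrt (real (card S + 1))"
      using central_binomial_le_real[of "card S"] by linarith
  qed simp
  also have "\<dots> = 2 ^ card X / sqrt (real (card S + 1))"
    using card_mono[OF X SX(1)] by (simp flip: power_add)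
  finally show ?thesis .
qed

section \<open>Eigenvectors of small support\<close>

text \<open>Matrices of arbitrary relations, loops and one-way arcs included, so that those of order
  \<open>k\<close> are indexed by all subsets of \<open>{..<k} \<times> {..<k}\<close>.\<close>

definition zero_one_mat :: "nat \<Rightarrow> (nat \<times> nat) set \<Rightarrow> real mat" where
  "zero_one_mat n E = mat n n (\<lambda>p. if p \<in> E then 1 else 0)"

lemma zero_one_mat_carrier [simp]: "zero_one_mat n E \<in> carrier_mat n n"
  by (simp add: zero_one_mat_def)

lemma adjacency_matrix_eq_zero_one_mat: "adjacency_matrix n G = zero_one_mat n (parcs G)"
  by (auto simp: adjacency_matrix_def zero_one_mat_def)

lemma zero_one_mat_mult_vec:
  assumes "i < n" "v \<in> carrier_vec n"
  shows "(zero_one_mat n E *\<^sub>v v) $ i = (\<Sum>j | j < n \<and> (i, j) \<in> E. v $ j)"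
proof -
  have "(zero_one_mat n E *\<^sub>v v) $ i = (\<Sum>j\<in>{0..<n}. if (i, j) \<in> E then v $ j else 0)"
    using assms by (auto simp: zero_one_mat_def scalar_prod_def intro!: sum.cong)
  also have "\<dots> = (\<Sum>j | j < n \<and> (i, j) \<in> E. v $ j)"
    by (simp add: sum.inter_filter[symmetric])
  finally show ?thesis .
qed

definition supp :: "real vec \<Rightarrow> nat set" where
  "supp v = {i. i < dim_vec v \<and> v $ i \<noteq> 0}"

text \<open>A neighbour sum of \<open>v\<close> only sees the support, so the eigenvalue equation
  survives restriction to the rows and columns of the support. Relabelling these makes the matrix
  independent of \<open>n\<close>.\<close>

lemma eigenvalue_of_small_support:
  assumes ev: "eigenvector (zero_one_mat n E) v \<mu>" and k: "card (supp v) \<le> k"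
  shows "\<exists>P \<subseteq> {..<k} \<times> {..<k}. \<mu> \<in> spectrum (zero_one_mat k P)"
proof -
  have v: "v \<in> carrier_vec n" "v \<noteq> 0\<^sub>v n" "zero_one_mat n E *\<^sub>v v = \<mu> \<cdot>\<^sub>v v"
    using ev by (auto simp: eigenvector_def zero_one_mat_def)
  let ?S = "supp v"
  have fin: "finite ?S" by (simp add: supp_def)
  define m where "m = card ?S"
  obtain f where f: "bij_betw f {0..<m} ?S"
    using ex_bij_betw_nat_finite[OF fin] m_def by blast
  have fS: "f a < n" "v $ f a \<noteq> 0" if "a < m" for a
    using bij_betwE[OF f] that v by (auto simp: supp_def)
  define P where "P = {(a, b). a < m \<and> b < m \<and> (f a, f b) \<in> E}"
  \<comment> \<open>Padding with zeros, at vertices isolated in \<open>P\<close>, brings every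
    support of size at most \<open>k\<close> to the common order \<open>k\<close>.\<close>
  define w where "w = vec k (\<lambda>a. if a < m then v $ f a else 0)"
  have w: "w \<in> carrier_vec k" by (simp add: w_def)
  have mk: "m \<le> k" using k m_def by simp
  have "zero_one_mat k P *\<^sub>v w = \<mu> \<cdot>\<^sub>v w"
  proof (rule eq_vecI)
    fix a assume "a < dim_vec (\<mu> \<cdot>\<^sub>v w)"
    then have a: "a < k" using w by simp
    show "(zero_one_mat k P *\<^sub>v w) $ a = (\<mu> \<cdot>\<^sub>v w) $ a"
    proof (cases "a < m")
      case True
      have "(zero_one_mat k P *\<^sub>v w) $ a = (\<Sum>b | b \<in> {0..<m} \<and> (f a, f b) \<in> E. v $ f b)"
        unfolding zero_one_mat_mult_vec[OF a w]
        by (rule sum.cong) (use True mk in \<open>auto simp: P_def w_def\<close>)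
      also have "\<dots> = (\<Sum>b\<in>{0..<m}. if (f a, f b) \<in> E then v $ f b else 0)"
        by (rule sum.inter_filter) simp
      also have "\<dots> = (\<Sum>j\<in>?S. if (f a, j) \<in> E then v $ j else 0)"
        by (rule sum.reindex_bij_betw[OF f])
      also have "\<dots> = (\<Sum>j | j \<in> ?S \<and> (f a, j) \<in> E. v $ j)"
        by (rule sum.inter_filter[OF fin, symmetric])
      also have "\<dots> = (\<Sum>j | j < n \<and> (f a, j) \<in> E. v $ j)"
        by (rule sum.mono_neutral_left) (use v in \<open>auto simp: supp_def\<close>)
      also have "\<dots> = (zero_one_mat n E *\<^sub>v v) $ f a"
        using zero_one_mat_mult_vec[OF fS(1)[OF True] v(1)] by simp
      also have "\<dots> = \<mu> * v $ f a" using v fS(1)[OF True] by simp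
      finally show ?thesis using True a by (simp add: w_def)
    next
      case False
      then show ?thesis
        using a unfolding zero_one_mat_mult_vec[OF a w] by (simp add: P_def w_def)
    qed
  qed (simp add: w_def zero_one_mat_def)
  moreover have "w \<noteq> 0\<^sub>v k"
  proof -
    \<comment> \<open>A nonzero \<open>v\<close> has nonempty support, so the entry of
      \<open>w\<close> at 0 comes from \<open>v\<close> and not from the padding.\<close>
    have "?S \<noteq> {}" using v by (auto simp: supp_def vec_eq_iff)
    then have "0 < m" using fin m_def by (simp add: card_gt_0_iff)
    then have "w $ 0 \<noteq> 0" "0 < k" using fS(2) mk by (auto simp: w_def)
    then show ?thesis by auto
  qed
  ultimately have "\<mu> \<in> spectrum (zero_one_mat k P)"
    using w by (auto simp: spectrum_def eigenvalue_def eigenvector_def zero_one_mat_def)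
  moreover have "P \<subseteq> {..<k} \<times> {..<k}" using mk by (auto simp: P_def)
  ultimately show ?thesis by blast
qed

text \<open>The bound does not depend on \<open>n\<close>: there are \<open>2 ^ k\<^sup>2\<close>
  relations on \<open>k\<close> points, each with at most \<open>k\<close> eigenvalues, and
  \<open>k\<close> is absorbed into a second factor \<open>2 ^ k\<^sup>2\<close>.\<close>

lemma card_small_support_eigenvalues_le:
  "card {\<mu>. \<exists>v. eigenvector (zero_one_mat n E) v \<mu> \<and> card (supp v) \<le> k} \<le> 4 ^ k\<^sup>2"
proof -
  let ?U = "\<Union>P\<in>Pow ({..<k} \<times> {..<k}). spectrum (zero_one_mat k P)"
  note spec = card_finite_spectrum[OF zero_one_mat_carrier]
  have "{\<mu>. \<exists>v. eigenvector (zero_one_mat n E) v \<mu> \<and> card (supp v) \<le> k} \<subseteq> ?U"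
  proof clarify
    fix \<mu> v
    assume "eigenvector (zero_one_mat n E) v \<mu>" "card (supp v) \<le> k"
    then show "\<mu> \<in> ?U" by (auto dest: eigenvalue_of_small_support)
  qed
  then have "card {\<mu>. \<exists>v. eigenvector (zero_one_mat n E) v \<mu> \<and> card (supp v) \<le> k} \<le> card ?U"
    using spec(1) by (intro card_mono) auto
  also have "\<dots> \<le> (\<Sum>P\<in>Pow ({..<k} \<times> {..<k}). card (spectrum (zero_one_mat k P)))"
    by (rule card_UN_le) simp
  also have "\<dots> \<le> (\<Sum>P\<in>Pow ({..<k} \<times> {..<k}). k)"
    by (rule sum_mono) (rule spec(2))
  also have "\<dots> = 2 ^ k\<^sup>2 * k"
    by (simp add: card_Pow card_cartesian_product power2_eq_square)
  also have "\<dots> \<le> 2 ^ k\<^sup>2 * 2 ^ k\<^sup>2"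
  proof (rule mult_left_mono)
    have "k \<le> k\<^sup>2" by (simp add: power2_eq_square)
    then show "k \<le> 2 ^ k\<^sup>2" using less_exp[of "k\<^sup>2"] by linarith
  qed simp
  also have "\<dots> = (4::nat) ^ k\<^sup>2" by (simp flip: power_mult_distrib)
  finally show ?thesis .
qed

section \<open>Random switchings\<close>

definition sign_vec :: "nat \<Rightarrow> nat set \<Rightarrow> real vec" where
  "sign_vec n T = vec n (\<lambda>i. if i \<in> T then 1 else -1)"

lemma sign_vec_switching: "sign_vec n T \<in> switchings n"
  by (auto simp: sign_vec_def switchings_def)

lemma sign_vec_scalar_prod:
  "v \<in> carrier_vec n \<Longrightarrow> sign_vec n T \<bullet> v = sign_sum {..<n} (($) v) T"
  by (auto simp: sign_vec_def sign_sum_def scalar_prod_def lessThan_atLeast0 intro!: sum.cong)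

text \<open>First-moment argument: some switching loses no more eigenvalues than the average. The
  threshold \<open>k\<close> stays free, to balance the two losses later.\<close>

lemma exists_switching_M_star_ge:
  fixes k n :: nat and G :: "nat pair_pre_digraph"
  defines "d \<equiv> card (spectrum (adjacency_matrix n G))"
  shows "\<exists>s \<in> switchings n. real (M_star n G s) \<ge> real d - 4 ^ k\<^sup>2 - real d / sqrt (real (k + 2))"
proof -
  let ?A = "adjacency_matrix n G"
  note spec = card_finite_spectrum[OF adjacency_matrix_carrier[of n G]]
  \<comment> \<open>Eigenvalues with at least one eigenvector of small support are given up. For the
    rest, \<open>L\<close>, any eigenvector serves as witness for Littlewood-Offord.\<close>
  define Sm where "Sm = {\<mu>. \<exists>v. eigenvector ?A v \<mu> \<and> card (supp v) \<le> k}"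
  define L where "L = spectrum ?A - Sm"
  define bad where "bad T \<mu> \<longleftrightarrow> eigenspace ?A \<mu> \<subseteq> perp (sign_vec n T)" for T \<mu>
  have finL: "finite L" using spec(1) by (simp add: L_def)
  have Ld: "card L \<le> d" using spec(1) by (simp add: L_def d_def card_mono)
  have SmS: "Sm \<subseteq> spectrum ?A"
    by (auto simp: Sm_def spectrum_def eigenvalue_def)
  have "card Sm \<le> 4 ^ k\<^sup>2"
    unfolding Sm_def adjacency_matrix_eq_zero_one_mat by (rule card_small_support_eigenvalues_le)
  then have Smk: "real (card Sm) \<le> 4 ^ k\<^sup>2"
    by (simp flip: of_nat_le_iff)
  have prob: "real (card {T \<in> Pow {..<n}. bad T \<mu>}) \<le> 2 ^ n / sqrt (real (k + 2))" if "\<mu> \<in> L" for \<mu>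
  proof -
    from that obtain v where ev: "eigenvector ?A v \<mu>" and big: "card (supp v) > k"
      by (force simp: L_def Sm_def spectrum_def eigenvalue_def)
    have v: "v \<in> carrier_vec n" "v \<in> eigenspace ?A \<mu>"
      using ev by (auto simp: eigenvector_def eigenspace_def adjacency_matrix_def)
    have "sign_sum {..<n} (($) v) T = 0" if "bad T \<mu>" for T
      using that v sign_vec_scalar_prod[OF v(1)] by (auto simp: bad_def perp_def)
    then have "card {T \<in> Pow {..<n}. bad T \<mu>}
        \<le> card {T \<in> Pow {..<n}. sign_sum {..<n} (($) v) T = 0}"
      by (intro card_mono) auto
    then have "real (card {T \<in> Pow {..<n}. bad T \<mu>})
        \<le> real (card {T \<in> Pow {..<n}. sign_sum {..<n} (($) v) T = 0})" by simp
    also have "\<dots> \<le> 2 ^ card {..<n} / sqrt (real (card (supp v) + 1))"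
      by (rule littlewood_offord_support) (use v in \<open>auto simp: supp_def\<close>)
    \<comment> \<open>The support has at least \<open>k + 1\<close> elements, whence
      \<open>k + 2\<close> under the root.\<close>
    also have "\<dots> \<le> 2 ^ n / sqrt (real (k + 2))"
      using big by (intro frac_le) auto
    finally show ?thesis .
  qed
  have "\<exists>T\<in>Pow {..<n}. real (card {\<mu> \<in> L. bad T \<mu>}) \<le> real d / sqrt (real (k + 2))"
  proof (rule ccontr)
    assume "\<not> ?thesis"
    then have "(\<Sum>T\<in>Pow {..<n}. real d / sqrt (real (k + 2)))
        < (\<Sum>T\<in>Pow {..<n}. real (card {\<mu> \<in> L. bad T \<mu>}))"
      by (intro sum_strict_mono) (auto simp: not_le)
    \<comment> \<open>The bad pairs of a sign set and an eigenvalue are counted first by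
      \<open>T\<close>, then by \<open>\<mu>\<close>.\<close>
    also have "\<dots> = (\<Sum>T\<in>Pow {..<n}. \<Sum>\<mu> | \<mu> \<in> L \<and> bad T \<mu>. 1)" by simp
    also have "\<dots> = (\<Sum>\<mu>\<in>L. \<Sum>T | T \<in> Pow {..<n} \<and> bad T \<mu>. 1)"
      by (rule sum.swap_restrict) (use finL in auto)
    also have "\<dots> \<le> (\<Sum>\<mu>\<in>L. 2 ^ n / sqrt (real (k + 2)))"
      by (rule sum_mono) (use prob in simp)
    also have "\<dots> \<le> real d * (2 ^ n / sqrt (real (k + 2)))"
      using Ld by (simp add: divide_right_mono mult_right_mono)
    finally show False by (simp add: card_Pow mult.commute)
  qed
  then obtain T where T: "real (card {\<mu> \<in> L. bad T \<mu>}) \<le> real d / sqrt (real (k + 2))" by blast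
  have "spectrum ?A \<subseteq> {\<mu> \<in> spectrum ?A. \<not> bad T \<mu>} \<union> (Sm \<union> {\<mu> \<in> L. bad T \<mu>})"
    by (auto simp: L_def)
  then have "d \<le> card ({\<mu> \<in> spectrum ?A. \<not> bad T \<mu>} \<union> (Sm \<union> {\<mu> \<in> L. bad T \<mu>}))"
    unfolding d_def using spec(1) finL finite_subset[OF SmS] by (intro card_mono) auto
  also have "\<dots> \<le> M_star n G (sign_vec n T) + (card Sm + card {\<mu> \<in> L. bad T \<mu>})"
    unfolding M_star_def bad_def
    by (intro order_trans[OF card_Un_le] add_mono card_Un_le order_refl)
  finally have "real d \<le> real (M_star n G (sign_vec n T)) + 4 ^ k\<^sup>2 + real d / sqrt (real (k + 2))"
    using Smk T by linarith
  then show ?thesis using sign_vec_switching by (intro bexI[of _ "sign_vec n T"]) auto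
qed

section \<open>Balancing the two error terms\<close>

theorem theorem1p5:
  shows "\<exists>C::real. C > 0 \<and>
    (\<forall>(n::nat) (G :: nat pair_pre_digraph) (d::nat).
       n \<ge> 5 \<longrightarrow> simple_graph_on n G \<longrightarrow>
       d = card (spectrum (adjacency_matrix n G)) \<longrightarrow> d \<ge> 2 \<longrightarrow>
       (\<exists>s \<in> switchings n.
          real (M_star n G s) \<ge> real d - C * (real d / (ln (real d)) powr (1/4))))"
\<comment> \<open>The constant 3 is 1 for the term \<open>4 ^ k\<^sup>2\<close> plus 2 for the
  Littlewood-Offord term.\<close>
proof (intro exI[of _ 3] conjI allI impI)
  fix n d :: nat and G :: "nat pair_pre_digraph"
  assume d: "d = card (spectrum (adjacency_matrix n G))" and d2: "d \<ge> 2"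
  define l where "l = ln (real d)"
  \<comment> \<open>With this \<open>k\<close>, the exponent \<open>k\<^sup>2\<close> is at most
    \<open>l / 4\<close>, which keeps \<open>4 ^ k\<^sup>2\<close> below the square root of
    \<open>d\<close>, while \<open>k + 2\<close> still has order at least
    \<open>sqrt l\<close>.\<close>
  define k where "k = nat \<lfloor>sqrt l / 2\<rfloor>"
  have l: "l > 0" and ld: "l \<le> real d" using d2 ln_bound[of "real d"] by (auto simp: l_def)
  have q: "l powr (1/4) > 0" using l by simp
  have lower: "real k \<le> sqrt l / 2" and upper: "sqrt l / 2 \<le> real (k + 2)"
    using l by (simp_all add: k_def of_nat_nat) linarith+
  obtain s where s: "s \<in> switchings n"
    and M: "real (M_star n G s) \<ge> real d - 4 ^ k\<^sup>2 - real d / sqrt (real (k + 2))"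
    using exists_switching_M_star_ge[of n G k] d by blast
  have "(4::real) ^ k\<^sup>2 \<le> real d / l powr (1/4)"
  proof -
    have "(real k)\<^sup>2 \<le> (sqrt l / 2)\<^sup>2" using lower by (intro power_mono) auto
    then have k2: "real (k\<^sup>2) \<le> l / 4" using l by (simp add: power_divide)
    have "ln (4::real) = 2 * ln 2" using ln_realpow[of 2 2] by simp
    then have "ln (4::real) \<le> 2" using ln_2_less_1 by simp
    then have "real (k\<^sup>2) * ln 4 \<le> l / 4 * 2" using k2 l by (intro mult_mono) auto
    moreover have "(4::real) ^ k\<^sup>2 = exp (real (k\<^sup>2) * ln 4)"
      using exp_of_nat_mult[of "k\<^sup>2" "ln (4::real)"] by simp
    ultimately have "(4::real) ^ k\<^sup>2 \<le> exp (l / 2)" by simp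
    also have "\<dots> = real d powr (1/2)" using d2 by (simp add: powr_def l_def)
    finally have "(4::real) ^ k\<^sup>2 \<le> real d powr (1/2)" .
    \<comment> \<open>The other factor \<open>real d powr (1/2)\<close> absorbs the logarithmic one,
      since \<open>l \<le> d\<close>.\<close>
    moreover have "l powr (1/4) \<le> real d powr (1/2)"
    proof -
      have "l powr (1/4) \<le> real d powr (1/4)" using l ld by (intro powr_mono2) auto
      also have "\<dots> \<le> real d powr (1/2)" using d2 by (intro powr_mono) auto
      finally show ?thesis .
    qed
    ultimately have "4 ^ k\<^sup>2 * l powr (1/4) \<le> real d powr (1/2) * real d powr (1/2)"
      by (intro mult_mono) auto
    also have "\<dots> = real d" using d2 by (simp flip: powr_add)
    finally show ?thesis using q by (simp add: field_simps)
  qed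
  moreover have "real d / sqrt (real (k + 2)) \<le> 2 * (real d / l powr (1/4))"
  proof -
    have "l powr (1/4) = sqrt (sqrt l)"
      using l by (simp add: powr_half_sqrt[symmetric] powr_powr)
    \<comment> \<open>\<open>upper\<close> gives \<open>sqrt l \<le> 2 * (k + 2)\<close>; the factor
      is enlarged to 4 so that its root is an integer.\<close>
    also have "\<dots> \<le> sqrt (4 * real (k + 2))" using upper by (intro real_sqrt_le_mono) auto
    also have "\<dots> = 2 * sqrt (real (k + 2))" by (simp only: real_sqrt_mult real_sqrt_four)
    finally have "l powr (1/4) / 2 \<le> sqrt (real (k + 2))" by simp
    then have "real d / sqrt (real (k + 2)) \<le> real d / (l powr (1/4) / 2)"
      using q by (intro divide_left_mono) auto
    then show ?thesis by (simp add: mult.commute)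
  qed
  ultimately have "real (M_star n G s) \<ge> real d - 3 * (real d / l powr (1/4))"
    using M by linarith
  then show "\<exists>s \<in> switchings n. real (M_star n G s) \<ge> real d - 3 * (real d / ln (real d) powr (1/4))"
    using s unfolding l_def by blast
qed simp

end
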